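(* Let $\Omega\subset\mathbb{C}$ be an open set, let $w=u+\sqrt{-1}\,v:\Omega\to\mathbb{C}$ be a complex-valued function with $u,v$ real-valued, and let $K=1+\kappa$ with $\kappa=\alpha+\sqrt{-1}\,\beta$, where $\alpha,\beta:\Omega\to\mathbb{R}$; the functions $u,v,\alpha,\beta$ are assumed continuous and differentiable as functions of the real variables $(x,y)$, $z=x+\sqrt{-1}\,y$. Then $w$ is structural holomorphic on $\Omega$ (with respect to $K=1+\kappa$) if and only if $$D_x u = D_y v,\qquad D_y u=-D_x v$$ on $\Omega$, where $$D_x=\frac{\partial}{\partial x}+\alpha_x-\beta_y,\qquad D_y=\frac{\partial}{\partial y}+\alpha_y+\beta_x .$$
   Context: Subscripts $x,y$ denote partial derivatives. In $D_x$ and $D_y$ the functions $\alpha_x-\beta_y$ and $\alpha_y+\beta_x$ act by multiplication, e.g. $D_x u=u_x+(\alpha_x-\beta_y)u$ and $D_y v=v_y+(\alpha_y+\beta_x)v$. The Wirtinger derivative is $\frac{\partial}{\partial\overline z}=\frac12\left(\frac{\partial}{\partial x}+\sqrt{-1}\frac{\partial}{\partial y}\right)$. For a complex-valued structural function $K$ on $\Omega$, the generalized structural Wirtinger derivative is $\frac{\mathrm{D}}{\partial\overline z}=\frac{\partial}{\partial\overline z}+\frac{\partial K}{\partial\overline z}$, where $\frac{\partial K}{\partial\overline z}$ acts by multiplication, i.e. $\frac{\mathrm{D}w}{\partial\overline z}=\frac{\partial w}{\partial\overline z}+w\frac{\partial K}{\partial\overline z}$ (for $K=1+\kappa$ one has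 $\frac{\partial K}{\partial\overline z}=\frac{\partial\kappa}{\partial\overline z}$). The function $w$ is called structural holomorphic on $\Omega$ if $\frac{\mathrm{D}w}{\partial\overline z}=0$ on $\Omega$. *)

theory Defs
  imports "HOL-Analysis.Analysis"
begin

definition partial_x :: "(complex \<Rightarrow> 'a::real_normed_vector) \<Rightarrow> complex \<Rightarrow> 'a" where
  "partial_x f z = vector_derivative (\<lambda>t. f (Complex t (Im z))) (at (Re z))"

definition partial_y :: "(complex \<Rightarrow> 'a::real_normed_vector) \<Rightarrow> complex \<Rightarrow> 'a" where
  "partial_y f z = vector_derivative (\<lambda>t. f (Complex (Re z) t)) (at (Im z))"

definition wirtinger_bar :: "(complex \<Rightarrow> complex) \<Rightarrow> complex \<Rightarrow> complex" where
  "wirtinger_bar f z = (1/2) * (partial_x f z + \<i> * partial_y f z)"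

definition structural_wirtinger_bar ::
    "(complex \<Rightarrow> complex) \<Rightarrow> (complex \<Rightarrow> complex) \<Rightarrow> complex \<Rightarrow> complex" where
  "structural_wirtinger_bar K w z = wirtinger_bar w z + w z * wirtinger_bar K z"

(* Intended for w and K that have partial derivatives at every point of the open set S;
   elsewhere vector_derivative is an unspecified value. *)
definition structural_holomorphic_on ::
    "(complex \<Rightarrow> complex) \<Rightarrow> (complex \<Rightarrow> complex) \<Rightarrow> complex set \<Rightarrow> bool" where
  "structural_holomorphic_on K w S \<longleftrightarrow> (\<forall>z\<in>S. structural_wirtinger_bar K w z = 0)"

definition D_x :: "(complex \<Rightarrow> real) \<Rightarrow> (complex \<Rightarrow> real) \<Rightarrow> (complex \<Rightarrow> real) \<Rightarrow> complex \<Rightarrow> real" where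
  "D_x \<alpha> \<beta> f z = partial_x f z + (partial_x \<alpha> z - partial_y \<beta> z) * f z"

definition D_y :: "(complex \<Rightarrow> real) \<Rightarrow> (complex \<Rightarrow> real) \<Rightarrow> (complex \<Rightarrow> real) \<Rightarrow> complex \<Rightarrow> real" where
  "D_y \<alpha> \<beta> f z = partial_y f z + (partial_y \<alpha> z + partial_x \<beta> z) * f z"

end

theory Submission
  imports Defs
begin

text \<open>
  The two equations are the real and imaginary parts of one complex identity. Writing
  \<open>p = \<alpha>\<^sub>x - \<beta>\<^sub>y\<close> and \<open>q = \<alpha>\<^sub>y + \<beta>\<^sub>x\<close>, the Cauchy-Riemann combination of the partial
  derivatives gives \<open>2 wirtinger_bar K = p + \<i> q\<close>, since the
  constant 1 in \<open>K\<close> drops out. Likewise twice the Wirtinger derivative of \<open>w\<close> is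
  \<open>(u\<^sub>x - v\<^sub>y) + \<i> (u\<^sub>y + v\<^sub>x)\<close>. Expanding \<open>(u + \<i> v) (p + \<i> q)\<close> and adding, the zeroth-order terms
  join the derivatives exactly as \<open>D\<^sub>x\<close> and \<open>D\<^sub>y\<close> prescribe, so twice the structural derivative is
  \<open>(D\<^sub>x u - D\<^sub>y v) + \<i> (D\<^sub>y u + D\<^sub>x v)\<close>. It vanishes iff both parts do.

  The analytic content is \<open>wirtinger_bar_Re_Im\<close>: real differentiability makes the partial
  derivatives genuine limits, and these depend on a function only near the point considered, so
  decompositions into real and imaginary parts on the open set determine them.
\<close>

lemma has_partial_x:
  assumes "f differentiable at z"
  shows "((\<lambda>t. f (Complex t (Im z))) has_vector_derivative partial_x f z) (at (Re z))"
proof -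
  have "(\<lambda>t. Complex t (Im z)) differentiable at (Re z)"
    unfolding Complex_eq by (intro derivative_intros)
  then have "(f \<circ> (\<lambda>t. Complex t (Im z))) differentiable at (Re z)"
    using assms by (simp add: differentiable_chain_at)
  then show ?thesis
    by (simp add: partial_x_def vector_derivative_works o_def)
qed

lemma has_partial_y:
  assumes "f differentiable at z"
  shows "((\<lambda>t. f (Complex (Re z) t)) has_vector_derivative partial_y f z) (at (Im z))"
proof -
  have "(\<lambda>t. Complex (Re z) t) differentiable at (Im z)"
    unfolding Complex_eq by (intro derivative_intros)
  then have "(f \<circ> (\<lambda>t. Complex (Re z) t)) differentiable at (Im z)"
    using assms by (simp add: differentiable_chain_at)
  then show ?thesis
    by (simp add: partial_y_def vector_derivative_works o_def)
qed

text \<open>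
  The additive constant \<open>c\<close> lets the same formula serve both \<open>w\<close> (with \<open>c = 0\<close>) and
  \<open>K = 1 + \<kappa>\<close> (with \<open>c = 1\<close>).
\<close>
lemma wirtinger_bar_Re_Im:
  fixes a b :: "complex \<Rightarrow> real"
  assumes "open S" "z \<in> S"
    and F: "\<And>x. x \<in> S \<Longrightarrow> F x = c + (complex_of_real (a x) + \<i> * complex_of_real (b x))"
    and a: "a differentiable at z" and b: "b differentiable at z"
  shows "wirtinger_bar F z =
    (1/2) * Complex (partial_x a z - partial_y b z) (partial_y a z + partial_x b z)"
proof -
  let ?G = "\<lambda>x. c + (complex_of_real (a x) + \<i> * complex_of_real (b x))"
  have op: "open ((\<lambda>t. Complex t (Im z)) -` S)"
    unfolding Complex_eq by (intro open_vimage \<open>open S\<close> continuous_intros)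
  have G: "((\<lambda>t. ?G (Complex t (Im z))) has_vector_derivative
      (0 + (complex_of_real (partial_x a z) + \<i> * complex_of_real (partial_x b z)))) (at (Re z))"
    by (intro has_vector_derivative_add has_vector_derivative_const
        has_vector_derivative_mult_right has_vector_derivative_of_real
        has_real_derivative_iff_has_vector_derivative[THEN iffD2] has_partial_x a b)
  have "((\<lambda>t. F (Complex t (Im z))) has_vector_derivative
      (0 + (complex_of_real (partial_x a z) + \<i> * complex_of_real (partial_x b z)))) (at (Re z))"
    by (rule has_vector_derivative_transform_within_open[OF G op]) (use \<open>z \<in> S\<close> F in auto)
  then have x: "partial_x F z = complex_of_real (partial_x a z) + \<i> * complex_of_real (partial_x b z)"
    by (simp add: partial_x_def vector_derivative_at)
  have op: "open ((\<lambda>t. Complex (Re z) t) -` S)"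
    unfolding Complex_eq by (intro open_vimage \<open>open S\<close> continuous_intros)
  have G: "((\<lambda>t. ?G (Complex (Re z) t)) has_vector_derivative
      (0 + (complex_of_real (partial_y a z) + \<i> * complex_of_real (partial_y b z)))) (at (Im z))"
    by (intro has_vector_derivative_add has_vector_derivative_const
        has_vector_derivative_mult_right has_vector_derivative_of_real
        has_real_derivative_iff_has_vector_derivative[THEN iffD2] has_partial_y a b)
  have "((\<lambda>t. F (Complex (Re z) t)) has_vector_derivative
      (0 + (complex_of_real (partial_y a z) + \<i> * complex_of_real (partial_y b z)))) (at (Im z))"
    by (rule has_vector_derivative_transform_within_open[OF G op]) (use \<open>z \<in> S\<close> F in auto)
  then have y: "partial_y F z = complex_of_real (partial_y a z) + \<i> * complex_of_real (partial_y b z)"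
    by (simp add: partial_y_def vector_derivative_at)
  show ?thesis
    by (simp add: wirtinger_bar_def x y complex_eq_iff)
qed

theorem theorem3:
  fixes \<Omega> :: "complex set"
    and w K \<kappa> :: "complex \<Rightarrow> complex"
    and u v \<alpha> \<beta> :: "complex \<Rightarrow> real"
  assumes "open \<Omega>"
    and "\<And>z. z \<in> \<Omega> \<Longrightarrow> w z = complex_of_real (u z) + \<i> * complex_of_real (v z)"
    and "\<And>z. z \<in> \<Omega> \<Longrightarrow> K z = 1 + \<kappa> z"
    and "\<And>z. z \<in> \<Omega> \<Longrightarrow> \<kappa> z = complex_of_real (\<alpha> z) + \<i> * complex_of_real (\<beta> z)"
    and "continuous_on \<Omega> u" "continuous_on \<Omega> v" "continuous_on \<Omega> \<alpha>" "continuous_on \<Omega> \<beta>"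
    and "u differentiable_on \<Omega>" "v differentiable_on \<Omega>"
      "\<alpha> differentiable_on \<Omega>" "\<beta> differentiable_on \<Omega>"
  shows "structural_holomorphic_on K w \<Omega> \<longleftrightarrow>
    (\<forall>z\<in>\<Omega>. D_x \<alpha> \<beta> u z = D_y \<alpha> \<beta> v z \<and> D_y \<alpha> \<beta> u z = - D_x \<alpha> \<beta> v z)"
proof -
  have eq: "structural_wirtinger_bar K w z = (1/2) *
      Complex (D_x \<alpha> \<beta> u z - D_y \<alpha> \<beta> v z) (D_y \<alpha> \<beta> u z + D_x \<alpha> \<beta> v z)" if z: "z \<in> \<Omega>" for z
  proof -
    have diff: "u differentiable at z" "v differentiable at z"
        "\<alpha> differentiable at z" "\<beta> differentiable at z"
      using assms(9-12) z \<open>open \<Omega>\<close> by (simp_all add: differentiable_on_eq_differentiable_at)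
    have w: "wirtinger_bar w z =
        (1/2) * Complex (partial_x u z - partial_y v z) (partial_y u z + partial_x v z)"
      using assms(2) diff by (intro wirtinger_bar_Re_Im[OF \<open>open \<Omega>\<close> z, where c = 0]) auto
    have K: "wirtinger_bar K z =
        (1/2) * Complex (partial_x \<alpha> z - partial_y \<beta> z) (partial_y \<alpha> z + partial_x \<beta> z)"
      using assms(3,4) diff by (intro wirtinger_bar_Re_Im[OF \<open>open \<Omega>\<close> z, where c = 1]) auto
    show ?thesis
      unfolding structural_wirtinger_bar_def w K
      by (simp add: assms(2)[OF z] D_x_def D_y_def complex_eq_iff field_simps)
  qed
  show ?thesis
    by (simp add: structural_holomorphic_on_def eq complex_eq_iff eq_neg_iff_add_eq_0)
qed

end
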